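(* Let $\{\Lambda_i\in L(H,H_i)\}_{i\in I}$ be a g-frame for $H$ with g-frame bounds $A,B$, and let $T,U\in GL(H)$. Let $0\le\lambda_1,\lambda_2<1$ be real numbers and let $\mathcal C=\{c_i\}_{i\in I}$ be a sequence of positive numbers with $\|\mathcal C\|_2=(\sum_{i\in I}c_i^2)^{1/2}<\infty$. Let $\{\Gamma_i\in L(H,H_i)\}_{i\in I}$ be a $(\lambda_1,\lambda_2,\mathcal C,T,U)$-perturbation of $\{\Lambda_i\}_{i\in I}$, and assume $$(1-\lambda_1)\sqrt{A}\,\|T^{-1}\|^{-1}>\|\mathcal C\|_2 .$$ Then $\{\Gamma_i\}_{i\in I}$ is a g-frame for $H$ with lower and upper g-frame bounds $$\left(\frac{(1-\lambda_1)\sqrt{A}\,\|T^{-1}\|^{-1}-\|\mathcal C\|_2}{1+\lambda_2}\,\|U\|^{-1}\right)^2,\qquad \left(\frac{(1+\lambda_1)\sqrt{B}\,\|T\|+\|\mathcal C\|_2}{1-\lambda_2}\,\|U\|^{-1}\right)^2 .$$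
   Context: $H$ is a separable Hilbert space, $I\subset\mathbb Z$, and $\{H_i\}_{i\in I}$ is a family of Hilbert spaces (closed subspaces of a common separable Hilbert space). $L(H,H_i)$ is the set of bounded linear operators $H\to H_i$; $GL(H)$ is the set of bounded linear operators on $H$ with bounded inverse. A family $\{\Lambda_i\in L(H,H_i)\}_{i\in I}$ is a g-frame for $H$ with bounds $0<A\le B<\infty$ if $A\|f\|^2\le\sum_{i\in I}\|\Lambda_if\|^2\le B\|f\|^2$ for all $f\in H$. A family $\{\Lambda_i\in L(H,H_i)\}_{i\in I}$ is g-complete if $\Lambda_if=0$ for all $i\in I$ implies $f=0$. For two g-complete families $\{\Lambda_i\in L(H,H_i)\}_{i\in I}$ and $\{\Gamma_i\in L(H,H_i)\}_{i\in I}$, the family $\{\Gamma_i\}$ is a $(\lambda_1,\lambda_2,\mathcal C,T,U)$-perturbation of $\{\Lambda_i\}$ if for all $i\in I$ and all $f\in H$, $$\|\Lambda_iTf-\Gamma_iUf\|\le\lambda_1\|\Lambda_iTf\|+\lambda_2\|\Gamma_iUf\|+c_i\|f\|.$$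
   Formalization: The upper g-frame bound is proved with ‖U^{-1}‖ in place of the printed ‖U‖^{-1}; the printed bound fails, e.g. for H=H_0=R^2, Λ_0=T=id, λ_1=λ_2=0, c_0=1/2, U=diag(1,1/4), Γ_0=diag(1,4). *)

theory Defs
  imports "HOL-Analysis.Analysis"
begin

(* A Hilbert space is a type of sort {real_inner, complete_space}. This also covers complex
   Hilbert spaces: with the real inner product Re <x,y> such a space is an instance with the same
   norm, its closed complex subspaces are closed real subspaces, and complex-linear bounded
   operators are real-linear bounded operators with the same norm and the same inverse. All
   notions below involve only the norm. *)

definition bounded_ops :: "'k set \<Rightarrow> ('h::real_normed_vector \<Rightarrow> 'k::real_normed_vector) set"
  where "bounded_ops K = {F. bounded_linear F \<and> range F \<subseteq> K}"

definition GL :: "('h::real_normed_vector \<Rightarrow> 'h) set"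
  where "GL = {T. bounded_linear T \<and> bij T \<and> bounded_linear (inv T)}"

(* Summability is required explicitly because infsum is 0 on families that are not summable. *)
definition g_frame ::
  "int set \<Rightarrow> (int \<Rightarrow> 'k::real_normed_vector set) \<Rightarrow>
   (int \<Rightarrow> 'h::real_normed_vector \<Rightarrow> 'k) \<Rightarrow> real \<Rightarrow> real \<Rightarrow> bool"
  where "g_frame I Hs \<Lambda> A B \<longleftrightarrow>
    (\<forall>i\<in>I. \<Lambda> i \<in> bounded_ops (Hs i)) \<and> 0 < A \<and> A \<le> B \<and>
    (\<forall>f. (\<lambda>i. (norm (\<Lambda> i f))\<^sup>2) summable_on I \<and>
         A * (norm f)\<^sup>2 \<le> (\<Sum>\<^sub>\<infinity>i\<in>I. (norm (\<Lambda> i f))\<^sup>2) \<and>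
         (\<Sum>\<^sub>\<infinity>i\<in>I. (norm (\<Lambda> i f))\<^sup>2) \<le> B * (norm f)\<^sup>2)"

definition g_complete ::
  "int set \<Rightarrow> (int \<Rightarrow> 'k::real_normed_vector set) \<Rightarrow>
   (int \<Rightarrow> 'h::real_normed_vector \<Rightarrow> 'k) \<Rightarrow> bool"
  where "g_complete I Hs \<Lambda> \<longleftrightarrow>
    (\<forall>i\<in>I. \<Lambda> i \<in> bounded_ops (Hs i)) \<and>
    (\<forall>f. (\<forall>i\<in>I. \<Lambda> i f = 0) \<longrightarrow> f = 0)"

(* The family \<Gamma> is a (l1, l2, c, T, U)-perturbation of the family \<Lambda>. *)
definition g_perturbation ::
  "int set \<Rightarrow> (int \<Rightarrow> 'k::real_normed_vector set) \<Rightarrow> real \<Rightarrow> real \<Rightarrow> (int \<Rightarrow> real) \<Rightarrow>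
   ('h::real_normed_vector \<Rightarrow> 'h) \<Rightarrow> ('h \<Rightarrow> 'h) \<Rightarrow>
   (int \<Rightarrow> 'h \<Rightarrow> 'k) \<Rightarrow> (int \<Rightarrow> 'h \<Rightarrow> 'k) \<Rightarrow> bool"
  where "g_perturbation I Hs l1 l2 c T U \<Lambda> \<Gamma> \<longleftrightarrow>
    g_complete I Hs \<Lambda> \<and> g_complete I Hs \<Gamma> \<and>
    (\<forall>i\<in>I. \<forall>f. norm (\<Lambda> i (T f) - \<Gamma> i (U f))
        \<le> l1 * norm (\<Lambda> i (T f)) + l2 * norm (\<Gamma> i (U f)) + c i * norm f)"

definition l2_norm :: "int set \<Rightarrow> (int \<Rightarrow> real) \<Rightarrow> real"
  where "l2_norm I c = sqrt (\<Sum>\<^sub>\<infinity>i\<in>I. (c i)\<^sup>2)"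

(* Pitfall: the upper g-frame bound of a perturbed frame involves the norm of the inverse of U, not
   the inverse of the norm of U (as it is sometimes printed). With the latter it is not a bound, e.g.
   for I = {0}, H = H_0 = R^2, \<Lambda>_0 = T = id, A = B = 1, l1 = l2 = 0, c_0 = 1/2,
   U = diag (1, 1/4), \<Gamma>_0 = diag (1, 4). *)

end

theory Submission
  imports Defs
begin

text \<open>For a fixed vector \<open>f\<close>, the triangle inequality turns the perturbation condition into
  two pointwise estimates between the sequences \<open>\<Lambda>\<^sub>i (T f)\<close> and \<open>\<Gamma>\<^sub>i (U f)\<close>:

  \<^item> \<open>(1 - l2) \<parallel>\<Gamma>\<^sub>i (U f)\<parallel> \<le> (1 + l1) \<parallel>\<Lambda>\<^sub>i (T f)\<parallel> + c\<^sub>i \<parallel>f\<parallel>\<close>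
  \<^item> \<open>(1 - l1) \<parallel>\<Lambda>\<^sub>i (T f)\<parallel> \<le> (1 + l2) \<parallel>\<Gamma>\<^sub>i (U f)\<parallel> + c\<^sub>i \<parallel>f\<parallel>\<close>

  Minkowski's inequality (\<open>minkowski_of_pointwise_le\<close>) carries both over to \<open>\<ell>\<^sup>2\<close>-norms, and the
  first one also yields the square summability of \<open>\<Gamma>\<^sub>i (U f)\<close>, on which the passage to
  \<open>\<ell>\<^sup>2\<close>-norms in the second one relies. The frame bounds of \<open>\<Lambda>\<close>, together with
  \<open>\<parallel>T\<^sup>-\<^sup>1\<parallel>\<^sup>-\<^sup>1 \<parallel>f\<parallel> \<le> \<parallel>T f\<parallel> \<le> \<parallel>T\<parallel> \<parallel>f\<parallel>\<close>, then bound the \<open>\<ell>\<^sup>2\<close>-norm of \<open>\<Gamma>\<^sub>i (U f)\<close> from both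
  sides by multiples of \<open>\<parallel>f\<parallel>\<close>.

  Since \<open>U\<close> is onto, every vector is of the form \<open>g = U f\<close>, and
  \<open>\<parallel>U\<parallel>\<^sup>-\<^sup>1 \<parallel>g\<parallel> \<le> \<parallel>f\<parallel> \<le> \<parallel>U\<^sup>-\<^sup>1\<parallel> \<parallel>g\<parallel>\<close> expresses these bounds in terms of \<open>g\<close>. The strict
  inequality assumed between \<open>A\<close> and the \<open>\<ell>\<^sup>2\<close>-norm of \<open>c\<close> makes the lower bound positive. It also
  excludes the zero space, where \<open>T\<^sup>-\<^sup>1\<close> has norm 0, whose reciprocal is 0 by convention; hence
  \<open>\<parallel>U\<parallel> > 0\<close>, and a nonzero vector shows that the lower bound does not exceed the upper one.\<close>

lemma l2_norm_nonneg: "0 \<le> l2_norm I p"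
  by (simp add: l2_norm_def infsum_nonneg)

lemma l2_norm_squared: "(l2_norm I p)\<^sup>2 = (\<Sum>\<^sub>\<infinity>i\<in>I. (p i)\<^sup>2)"
  by (simp add: l2_norm_def infsum_nonneg)

lemma l2_norm_mult:
  assumes "0 \<le> a"
  shows "l2_norm I (\<lambda>i. a * p i) = a * l2_norm I p"
  using assms
  by (simp add: l2_norm_def power_mult_distrib infsum_cmult_right' real_sqrt_mult)

lemma L2_set_le_l2_norm:
  assumes "(\<lambda>i. (p i)\<^sup>2) summable_on I" and "finite F" and "F \<subseteq> I"
  shows "L2_set p F \<le> l2_norm I p"
  unfolding L2_set_def l2_norm_def
  using assms by (intro real_sqrt_le_mono finite_sum_le_infsum) auto

text \<open>The finite form of Minkowski's inequality bounds every finite partial sum of \<open>(r i)\<^sup>2\<close> by the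
  same constant, which gives summability and the estimate of the infinite sum at once.\<close>

lemma minkowski_of_pointwise_le:
  assumes p: "(\<lambda>i. (p i)\<^sup>2) summable_on I" and q: "(\<lambda>i. (q i)\<^sup>2) summable_on I"
    and r: "\<And>i. i \<in> I \<Longrightarrow> 0 \<le> r i" "\<And>i. i \<in> I \<Longrightarrow> r i \<le> p i + q i"
  shows "(\<lambda>i. (r i)\<^sup>2) summable_on I"
    and "l2_norm I r \<le> l2_norm I p + l2_norm I q"
proof -
  let ?M = "l2_norm I p + l2_norm I q"
  have M: "0 \<le> ?M"
    by (simp add: l2_norm_nonneg)
  have partial: "(\<Sum>i\<in>F. (r i)\<^sup>2) \<le> ?M\<^sup>2" if F: "finite F" "F \<subseteq> I" for F
  proof -
    have "L2_set r F \<le> L2_set (\<lambda>i. p i + q i) F"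
      using F r by (intro L2_set_mono) auto
    also have "\<dots> \<le> L2_set p F + L2_set q F"
      by (rule L2_set_triangle_ineq)
    also have "\<dots> \<le> ?M"
      using F p q by (intro add_mono L2_set_le_l2_norm)
    finally have "sqrt (\<Sum>i\<in>F. (r i)\<^sup>2) \<le> ?M"
      by (simp add: L2_set_def)
    then show ?thesis
      by (rule sqrt_le_D)
  qed
  show summable: "(\<lambda>i. (r i)\<^sup>2) summable_on I"
    using partial by (intro nonneg_bdd_above_summable_on bdd_aboveI[where M = "?M\<^sup>2"]) auto
  have "(\<Sum>\<^sub>\<infinity>i\<in>I. (r i)\<^sup>2) \<le> ?M\<^sup>2"
    using partial by (intro infsum_le_finite_sums summable)
  then show "l2_norm I r \<le> ?M"
    using M by (simp add: l2_norm_def real_le_lsqrt infsum_nonneg)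
qed

text \<open>Frame inequalities compare squares, whereas Minkowski's inequality and operator norms
  are linear in the norms. The next two lemmas take square roots before the argument and squares
  after it.\<close>

lemma g_frame_l2_norm_bounds:
  assumes "g_frame I Hs \<Lambda> A B"
  shows "(\<lambda>i. (norm (\<Lambda> i f))\<^sup>2) summable_on I"
    and "sqrt A * norm f \<le> l2_norm I (\<lambda>i. norm (\<Lambda> i f))"
    and "l2_norm I (\<lambda>i. norm (\<Lambda> i f)) \<le> sqrt B * norm f"
proof -
  have *: "(\<lambda>i. (norm (\<Lambda> i f))\<^sup>2) summable_on I"
    "A * (norm f)\<^sup>2 \<le> (\<Sum>\<^sub>\<infinity>i\<in>I. (norm (\<Lambda> i f))\<^sup>2)"
    "(\<Sum>\<^sub>\<infinity>i\<in>I. (norm (\<Lambda> i f))\<^sup>2) \<le> B * (norm f)\<^sup>2"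
    using assms by (auto simp: g_frame_def)
  show "(\<lambda>i. (norm (\<Lambda> i f))\<^sup>2) summable_on I"
    by (rule *)
  show "sqrt A * norm f \<le> l2_norm I (\<lambda>i. norm (\<Lambda> i f))"
    using real_sqrt_le_mono[OF *(2)] by (simp add: l2_norm_def real_sqrt_mult)
  show "l2_norm I (\<lambda>i. norm (\<Lambda> i f)) \<le> sqrt B * norm f"
    using real_sqrt_le_mono[OF *(3)] by (simp add: l2_norm_def real_sqrt_mult)
qed

lemma g_frame_from_l2_norm_bounds:
  fixes \<Gamma> :: "int \<Rightarrow> 'h::real_normed_vector \<Rightarrow> 'k::real_normed_vector"
  assumes ops: "\<And>i. i \<in> I \<Longrightarrow> \<Gamma> i \<in> bounded_ops (Hs i)"
    and "0 < a" and "0 \<le> b" and "(x :: 'h) \<noteq> 0"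
    and summable: "\<And>f. (\<lambda>i. (norm (\<Gamma> i f))\<^sup>2) summable_on I"
    and lower: "\<And>f. a * norm f \<le> l2_norm I (\<lambda>i. norm (\<Gamma> i f))"
    and upper: "\<And>f. l2_norm I (\<lambda>i. norm (\<Gamma> i f)) \<le> b * norm f"
  shows "g_frame I Hs \<Gamma> (a\<^sup>2) (b\<^sup>2)"
proof -
  have "a * norm x \<le> b * norm x"
    using lower upper by (rule order_trans)
  then have "a \<le> b"
    using \<open>x \<noteq> 0\<close> by simp
  then have "a\<^sup>2 \<le> b\<^sup>2"
    using \<open>0 < a\<close> by (simp add: power_mono)
  moreover have "a\<^sup>2 * (norm f)\<^sup>2 \<le> (\<Sum>\<^sub>\<infinity>i\<in>I. (norm (\<Gamma> i f))\<^sup>2)" for f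
    using power_mono[OF lower, of f 2] \<open>0 < a\<close>
    by (simp add: l2_norm_squared power_mult_distrib)
  moreover have "(\<Sum>\<^sub>\<infinity>i\<in>I. (norm (\<Gamma> i f))\<^sup>2) \<le> b\<^sup>2 * (norm f)\<^sup>2" for f
    using power_mono[OF upper l2_norm_nonneg, of f 2]
    by (simp add: l2_norm_squared power_mult_distrib)
  ultimately show ?thesis
    using ops summable \<open>0 < a\<close> by (auto simp: g_frame_def)
qed

text \<open>Division by zero yields zero, so the next estimate also covers operators of norm 0.\<close>

lemma inverse_onorm_mult_norm_le:
  assumes "bounded_linear S"
  shows "inverse (onorm S) * norm (S g) \<le> norm g"
proof (cases "onorm S = 0")
  case False
  then have "0 < onorm S"
    using onorm_pos_le[OF assms] by simp
  then show ?thesis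
    using onorm[OF assms, of g] by (simp add: field_simps)
qed simp

theorem theorem4p2:
  fixes I :: "int set"
    and Hs :: "int \<Rightarrow> 'k::{real_inner, complete_space} set"
    and \<Lambda> \<Gamma> :: "int \<Rightarrow> 'h::{real_inner, complete_space} \<Rightarrow> 'k"
    and T U :: "'h \<Rightarrow> 'h"
    and A B l1 l2 :: real
    and c :: "int \<Rightarrow> real"
  assumes "separable_space (euclidean :: 'h topology)"
    and "separable_space (euclidean :: 'k topology)"
    and "\<And>i. i \<in> I \<Longrightarrow> subspace (Hs i) \<and> closed (Hs i)"
    and "g_frame I Hs \<Lambda> A B"
    and "T \<in> GL" and "U \<in> GL"
    and "0 \<le> l1" and "l1 < 1" and "0 \<le> l2" and "l2 < 1"
    and "\<And>i. i \<in> I \<Longrightarrow> 0 < c i"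
    and "(\<lambda>i. (c i)\<^sup>2) summable_on I"
    and "g_perturbation I Hs l1 l2 c T U \<Lambda> \<Gamma>"
    and "(1 - l1) * sqrt A * inverse (onorm (inv T)) > l2_norm I c"
  shows "g_frame I Hs \<Gamma>
    ((((1 - l1) * sqrt A * inverse (onorm (inv T)) - l2_norm I c) / (1 + l2)
        * inverse (onorm U))\<^sup>2)
    ((((1 + l1) * sqrt B * onorm T + l2_norm I c) / (1 - l2)
        * onorm (inv U))\<^sup>2)"
proof -
  let ?C = "l2_norm I c"
  have T: "bounded_linear T" "bij T" "bounded_linear (inv T)"
    and U: "bounded_linear U" "bij U" "bounded_linear (inv U)"
    using assms(5,6) by (auto simp: GL_def)
  have "0 < A" and "A \<le> B"
    using assms(4) by (auto simp: g_frame_def)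
  have ops: "\<Gamma> i \<in> bounded_ops (Hs i)" if "i \<in> I" for i
    using assms(13) that by (auto simp: g_perturbation_def g_complete_def)
  have pert: "norm (\<Lambda> i (T f) - \<Gamma> i (U f))
      \<le> l1 * norm (\<Lambda> i (T f)) + l2 * norm (\<Gamma> i (U f)) + c i * norm f" if "i \<in> I" for i f
    using assms(13) that by (auto simp: g_perturbation_def)
  have C: "0 \<le> ?C"
    by (rule l2_norm_nonneg)
  note frame = g_frame_l2_norm_bounds[OF assms(4)]

  have summable_\<Lambda>T: "(\<lambda>i. (a * norm (\<Lambda> i (T f)))\<^sup>2) summable_on I" for a f
    using frame(1)[of "T f"] by (simp add: power_mult_distrib summable_on_cmult_right)
  have summable_c: "(\<lambda>i. (a * c i)\<^sup>2) summable_on I" for a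
    using assms(12) by (simp add: power_mult_distrib summable_on_cmult_right)

  have upper_pointwise:
    "(1 - l2) * norm (\<Gamma> i (U f)) \<le> (1 + l1) * norm (\<Lambda> i (T f)) + norm f * c i"
    if "i \<in> I" for i f
    using pert[OF that, of f] norm_triangle_ineq2[of "\<Gamma> i (U f)" "\<Lambda> i (T f)"]
    by (simp add: norm_minus_commute algebra_simps)
  have lower_pointwise:
    "(1 - l1) * norm (\<Lambda> i (T f)) \<le> (1 + l2) * norm (\<Gamma> i (U f)) + norm f * c i"
    if "i \<in> I" for i f
    using pert[OF that, of f] norm_triangle_ineq2[of "\<Lambda> i (T f)" "\<Gamma> i (U f)"]
    by (simp add: algebra_simps)

  have "(\<lambda>i. ((1 - l2) * norm (\<Gamma> i (U f)))\<^sup>2) summable_on I" for f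
    using assms(10) upper_pointwise
    by (intro minkowski_of_pointwise_le(1)[OF summable_\<Lambda>T[of "1 + l1" f] summable_c[of "norm f"]]) auto
  then have summable_\<Gamma>U: "(\<lambda>i. (norm (\<Gamma> i (U f)))\<^sup>2) summable_on I" for f
    using assms(10) by (simp add: power_mult_distrib summable_on_cmult_right')

  have upper_\<Gamma>U:
    "(1 - l2) * l2_norm I (\<lambda>i. norm (\<Gamma> i (U f))) \<le> ((1 + l1) * sqrt B * onorm T + ?C) * norm f"
    for f
  proof -
    have "l2_norm I (\<lambda>i. (1 - l2) * norm (\<Gamma> i (U f)))
        \<le> l2_norm I (\<lambda>i. (1 + l1) * norm (\<Lambda> i (T f))) + l2_norm I (\<lambda>i. norm f * c i)"
      using assms(10) upper_pointwise
      by (intro minkowski_of_pointwise_le(2) summable_\<Lambda>T summable_c) auto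
    then have "(1 - l2) * l2_norm I (\<lambda>i. norm (\<Gamma> i (U f)))
        \<le> (1 + l1) * l2_norm I (\<lambda>i. norm (\<Lambda> i (T f))) + norm f * ?C"
      using assms(7,10) by (simp add: l2_norm_mult)
    also have "\<dots> \<le> (1 + l1) * (sqrt B * (onorm T * norm f)) + norm f * ?C"
      using order_trans[OF frame(3)[of "T f"] mult_left_mono[OF onorm[OF T(1), of f]]]
        assms(7) \<open>0 < A\<close> \<open>A \<le> B\<close>
      by (intro add_right_mono mult_left_mono) auto
    finally show ?thesis
      by (simp add: algebra_simps)
  qed

  have lower_\<Gamma>U:
    "((1 - l1) * sqrt A * inverse (onorm (inv T)) - ?C) * norm f
      \<le> (1 + l2) * l2_norm I (\<lambda>i. norm (\<Gamma> i (U f)))" for f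
  proof -
    have "(\<lambda>i. ((1 + l2) * norm (\<Gamma> i (U f)))\<^sup>2) summable_on I"
      using summable_\<Gamma>U by (simp add: power_mult_distrib summable_on_cmult_right)
    then have "l2_norm I (\<lambda>i. (1 - l1) * norm (\<Lambda> i (T f)))
        \<le> l2_norm I (\<lambda>i. (1 + l2) * norm (\<Gamma> i (U f))) + l2_norm I (\<lambda>i. norm f * c i)"
      using assms(8) lower_pointwise
      by (intro minkowski_of_pointwise_le(2) summable_\<Lambda>T summable_c) auto
    then have "(1 - l1) * l2_norm I (\<lambda>i. norm (\<Lambda> i (T f)))
        \<le> (1 + l2) * l2_norm I (\<lambda>i. norm (\<Gamma> i (U f))) + norm f * ?C"
      using assms(8,9) by (simp add: l2_norm_mult)
    moreover have "inverse (onorm (inv T)) * norm f \<le> norm (T f)"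
      using inverse_onorm_mult_norm_le[OF T(3), of "T f"] T(2)
      by (simp add: bij_is_inj)
    then have "sqrt A * (inverse (onorm (inv T)) * norm f) \<le> l2_norm I (\<lambda>i. norm (\<Lambda> i (T f)))"
      using order_trans[OF mult_left_mono frame(2)[of "T f"]] \<open>0 < A\<close> by simp
    then have "(1 - l1) * (sqrt A * (inverse (onorm (inv T)) * norm f))
        \<le> (1 - l1) * l2_norm I (\<lambda>i. norm (\<Lambda> i (T f)))"
      using assms(8) by (simp add: mult_left_mono)
    ultimately show ?thesis
      by (simp add: algebra_simps)
  qed

  (* In the zero space the assumed strict inequality would read 0 > ?C. *)
  have "onorm (inv T) \<noteq> 0"
    using assms(14) C by auto
  then obtain x where "inv T x \<noteq> 0"
    using onorm_eq_0[OF T(3)] by blast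
  then have "U (inv T x) \<noteq> 0"
    using U(1,2) by (metis bij_is_inj inv_f_f linear_0 bounded_linear.linear)
  then have "0 < onorm U"
    using onorm_pos_lt[OF U(1)] by blast

  have U_inv: "U (inv U g) = g" for g
    using U(2) by (simp add: bij_is_surj surj_f_inv_f)
  show ?thesis
  proof (rule g_frame_from_l2_norm_bounds)
    show "inv T x \<noteq> 0"
      by fact
    show "0 < ((1 - l1) * sqrt A * inverse (onorm (inv T)) - ?C) / (1 + l2) * inverse (onorm U)"
      using assms(9,14) \<open>0 < onorm U\<close> by simp
    show "0 \<le> ((1 + l1) * sqrt B * onorm T + ?C) / (1 - l2) * onorm (inv U)"
      using assms(7,10) \<open>0 < A\<close> \<open>A \<le> B\<close> C onorm_pos_le[OF T(1)] onorm_pos_le[OF U(3)] by simp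
    show "(\<lambda>i. (norm (\<Gamma> i g))\<^sup>2) summable_on I" for g
      using summable_\<Gamma>U[of "inv U g"] by (simp add: U_inv)
    show "((1 - l1) * sqrt A * inverse (onorm (inv T)) - ?C) / (1 + l2) * inverse (onorm U) * norm g
        \<le> l2_norm I (\<lambda>i. norm (\<Gamma> i g))" for g
    proof -
      let ?a = "(1 - l1) * sqrt A * inverse (onorm (inv T)) - ?C"
      have "inverse (onorm U) * norm g \<le> norm (inv U g)"
        using inverse_onorm_mult_norm_le[OF U(1), of "inv U g"] by (simp add: U_inv)
      then have "?a * (inverse (onorm U) * norm g) \<le> ?a * norm (inv U g)"
        using assms(14) by (intro mult_left_mono) auto
      also have "\<dots> \<le> (1 + l2) * l2_norm I (\<lambda>i. norm (\<Gamma> i g))"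
        using lower_\<Gamma>U[of "inv U g"] by (simp add: U_inv)
      finally have "?a * (inverse (onorm U) * norm g) / (1 + l2) \<le> l2_norm I (\<lambda>i. norm (\<Gamma> i g))"
        using assms(9) by (simp add: pos_divide_le_eq mult.commute)
      then show ?thesis
        by (simp add: mult.assoc)
    qed
    show "l2_norm I (\<lambda>i. norm (\<Gamma> i g))
        \<le> ((1 + l1) * sqrt B * onorm T + ?C) / (1 - l2) * onorm (inv U) * norm g" for g
    proof -
      let ?b = "(1 + l1) * sqrt B * onorm T + ?C"
      have "(1 - l2) * l2_norm I (\<lambda>i. norm (\<Gamma> i g)) \<le> ?b * norm (inv U g)"
        using upper_\<Gamma>U[of "inv U g"] by (simp add: U_inv)
      also have "\<dots> \<le> ?b * (onorm (inv U) * norm g)"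
        using onorm[OF U(3), of g] assms(7) \<open>0 < A\<close> \<open>A \<le> B\<close> C onorm_pos_le[OF T(1)]
        by (intro mult_left_mono) auto
      finally have "l2_norm I (\<lambda>i. norm (\<Gamma> i g)) \<le> ?b * (onorm (inv U) * norm g) / (1 - l2)"
        using assms(10) by (simp add: pos_le_divide_eq mult.commute)
      then show ?thesis
        by (simp add: mult.assoc)
    qed
  qed (use ops in auto)
qed

end
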